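(* For any dynamic theory $\Delta$, its regular closure $\Delta^{r}$ (same variables, atoms, universe, states, variable evaluation, atom evaluation and $\mathrm{FV}_A$, with programs $\mathcal P^r$, evaluation $\mathcal E_P^r$ and free-variable function $\mathrm{FV}_P^r$ as defined below) is a dynamic theory.
   Context: A dynamic theory $\Delta$ consists of: pairwise disjoint sets $\mathcal V$ (variables), $\mathcal A$ (atoms), $\mathcal P$ (programs); a nonempty set $U$; a nonempty set $S$ of states with $\mathrm{val}:S\times\mathcal V\to U$ satisfying interpolation (for all $\mu,\nu\in S$, $W\subseteq\mathcal V$ there is $\omega\in S$ agreeing with $\mu$ on $W$ and with $\nu$ outside $W$); $\mathcal E_A:\mathcal A\to2^S$ and $\mathrm{FV}_A:\mathcal A\to 2^{\mathcal V}$ with $\mathrm{FV}_A(a)$ finite and states agreeing on $\mathrm{FV}_A(a)$ both in or both out of $\mathcal E_A(a)$; $\mathcal E_P:\mathcal P\to 2^{S\times S}$ and $\mathrm{FV}_P:\mathcal P\to2^{\mathcal V}$ with $\mathrm{FV}_P(p)$ finite, overapproximation (for all $W\supseteq\mathrm{FV}_P(p)$: if $\mu=_W\nu$ and $(\mu,\omega)\in\mathcal E_P(p)$ then some $\tilde\omega$ has $(\nu,\tilde\omega)\in\mathcal E_P(p)$, $\omega=_W\tilde\omega$) and extensionality (if $\mu=_{\mathcal V}\nu$ then $(\mu,\omega)\in\mathcal E_P(p)\iff(\nu,\omega)\in\mathcal E_P(p)$). $\mu=_W\nu$ means $\mathrm{val}(\mu,v)=\mathrm{val}(\nu,v)$ for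 all $v\in W$. First-order formulas: $F::=a\mid\neg F\mid F\wedge G\mid\forall vF$, with semantics $[\![a]\!]=\mathcal E_A(a)$, complement, intersection, $[\![\forall vF]\!]=\{\mu:\forall\nu(\mu=_{\mathcal V\setminus\{v\}}\nu\Rightarrow\nu\in[\![F]\!])\}$; syntactic free variables $\mathrm{FV}^{syn}(a)=\mathrm{FV}_A(a)$, $\mathrm{FV}^{syn}(\neg F)=\mathrm{FV}^{syn}(F)$, $\mathrm{FV}^{syn}(F\wedge G)=\mathrm{FV}^{syn}(F)\cup\mathrm{FV}^{syn}(G)$, $\mathrm{FV}^{syn}(\forall vF)=\mathrm{FV}^{syn}(F)\setminus\{v\}$. Regular closure: $\mathcal P^r$ is generated by $p,q::=r\mid p;q\mid p\cup q\mid ?(\phi)\mid p^*$ with $r\in\mathcal P$ and $\phi$ a first-order formula. $\mathcal E^r_P(r)=\mathcal E_P(r)$; $\mathcal E^r_P(p;q)=\{(\mu,\omega):\exists\nu,(\mu,\nu)\in\mathcal E^r_P(p),(\nu,\omega)\in\mathcal E^r_P(q)\}$; $\mathcal E^r_P(p\cup q)=\mathcal E^r_P(p)\cup\mathcal E^r_P(q)$; $\mathcal E^r_P(?(\phi))=\{(\mu,\nu):\mu\in[\![\phi]\!],\ \mu=_{\mathcal V}\nu\}$; $\mathcal E^r_P(p^* )=\bigcup_{n\in\mathbb N}\mathcal E^r_P(p^n)$ with $p^0=?(\top)$, $p^{n+1}=p;p^n$. $\mathrm{FV}^r_P(r)=\mathrm{FV}_P(r)$; $\mathrm{FV}^r_P(p;q)=\mathrm{FV}^r_P(p\cup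 q)=\mathrm{FV}^r_P(p)\cup\mathrm{FV}^r_P(q)$; $\mathrm{FV}^r_P(?(\phi))=\mathrm{FV}^{syn}(\phi)$; $\mathrm{FV}^r_P(p^* )=\mathrm{FV}^r_P(p)$. *)

theory Defs
  imports Main
begin

text \<open>
  Variables, atoms and programs live in three separate types, which renders the requirement that
  the three sets be pairwise disjoint. All carriers are explicit sets, so that variables, atoms or
  programs may be absent; only the universe and the state space are required to be nonempty.
\<close>

record ('v, 'a, 'p, 'u, 's) dyn_structure =
  vars :: "'v set"
  atoms :: "'a set"
  progs :: "'p set"
  univ :: "'u set"
  states :: "'s set"
  val :: "'s \<Rightarrow> 'v \<Rightarrow> 'u"
  eval_atom :: "'a \<Rightarrow> 's set"
  fv_atom :: "'a \<Rightarrow> 'v set"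
  eval_prog :: "'p \<Rightarrow> ('s \<times> 's) set"
  fv_prog :: "'p \<Rightarrow> 'v set"

definition agree :: "('v, 'a, 'p, 'u, 's) dyn_structure \<Rightarrow> 'v set \<Rightarrow> 's \<Rightarrow> 's \<Rightarrow> bool" where
  "agree D W \<mu> \<nu> \<longleftrightarrow> (\<forall>v\<in>W. val D \<mu> v = val D \<nu> v)"

locale dynamic_theory =
  fixes D :: "('v, 'a, 'p, 'u, 's) dyn_structure"
  assumes univ_nonempty: "univ D \<noteq> {}"
    and states_nonempty: "states D \<noteq> {}"
    and val_in_univ: "\<lbrakk>\<mu> \<in> states D; v \<in> vars D\<rbrakk> \<Longrightarrow> val D \<mu> v \<in> univ D"
    and interpolation:
      "\<lbrakk>\<mu> \<in> states D; \<nu> \<in> states D; W \<subseteq> vars D\<rbrakk> \<Longrightarrow>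
        \<exists>\<omega>\<in>states D. agree D W \<omega> \<mu> \<and> agree D (vars D - W) \<omega> \<nu>"
    and eval_atom_states: "a \<in> atoms D \<Longrightarrow> eval_atom D a \<subseteq> states D"
    and fv_atom_vars: "a \<in> atoms D \<Longrightarrow> fv_atom D a \<subseteq> vars D"
    and fv_atom_finite: "a \<in> atoms D \<Longrightarrow> finite (fv_atom D a)"
    and atom_coincidence:
      "\<lbrakk>a \<in> atoms D; \<mu> \<in> states D; \<nu> \<in> states D; agree D (fv_atom D a) \<mu> \<nu>\<rbrakk> \<Longrightarrow>
        \<mu> \<in> eval_atom D a \<longleftrightarrow> \<nu> \<in> eval_atom D a"
    and eval_prog_states: "p \<in> progs D \<Longrightarrow> eval_prog D p \<subseteq> states D \<times> states D"
    and fv_prog_vars: "p \<in> progs D \<Longrightarrow> fv_prog D p \<subseteq> vars D"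
    and fv_prog_finite: "p \<in> progs D \<Longrightarrow> finite (fv_prog D p)"
    and overapproximation:
      "\<lbrakk>p \<in> progs D; fv_prog D p \<subseteq> W; W \<subseteq> vars D;
        \<mu> \<in> states D; \<nu> \<in> states D; \<omega> \<in> states D;
        agree D W \<mu> \<nu>; (\<mu>, \<omega>) \<in> eval_prog D p\<rbrakk> \<Longrightarrow>
        \<exists>\<omega>'\<in>states D. (\<nu>, \<omega>') \<in> eval_prog D p \<and> agree D W \<omega> \<omega>'"
    and extensionality:
      "\<lbrakk>p \<in> progs D; \<mu> \<in> states D; \<nu> \<in> states D; \<omega> \<in> states D; agree D (vars D) \<mu> \<nu>\<rbrakk> \<Longrightarrow>
        (\<mu>, \<omega>) \<in> eval_prog D p \<longleftrightarrow> (\<nu>, \<omega>) \<in> eval_prog D p"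

datatype ('v, 'a) fml =
    Atom 'a
  | Neg "('v, 'a) fml"
  | And "('v, 'a) fml" "('v, 'a) fml"
  | All 'v "('v, 'a) fml"

inductive_set fmls :: "('v, 'a, 'p, 'u, 's) dyn_structure \<Rightarrow> ('v, 'a) fml set"
  for D :: "('v, 'a, 'p, 'u, 's) dyn_structure" where
    Atom: "a \<in> atoms D \<Longrightarrow> Atom a \<in> fmls D"
  | Neg: "F \<in> fmls D \<Longrightarrow> Neg F \<in> fmls D"
  | And: "\<lbrakk>F \<in> fmls D; G \<in> fmls D\<rbrakk> \<Longrightarrow> And F G \<in> fmls D"
  | All: "\<lbrakk>v \<in> vars D; F \<in> fmls D\<rbrakk> \<Longrightarrow> All v F \<in> fmls D"

primrec eval_fml :: "('v, 'a, 'p, 'u, 's) dyn_structure \<Rightarrow> ('v, 'a) fml \<Rightarrow> 's set" where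
  "eval_fml D (Atom a) = eval_atom D a"
| "eval_fml D (Neg F) = states D - eval_fml D F"
| "eval_fml D (And F G) = eval_fml D F \<inter> eval_fml D G"
| "eval_fml D (All v F) =
    {\<mu> \<in> states D. \<forall>\<nu>\<in>states D. agree D (vars D - {v}) \<mu> \<nu> \<longrightarrow> \<nu> \<in> eval_fml D F}"

primrec fv_fml :: "('v, 'a, 'p, 'u, 's) dyn_structure \<Rightarrow> ('v, 'a) fml \<Rightarrow> 'v set" where
  "fv_fml D (Atom a) = fv_atom D a"
| "fv_fml D (Neg F) = fv_fml D F"
| "fv_fml D (And F G) = fv_fml D F \<union> fv_fml D G"
| "fv_fml D (All v F) = fv_fml D F - {v}"

datatype ('v, 'a, 'p) rprog =
    Base 'p
  | Seq "('v, 'a, 'p) rprog" "('v, 'a, 'p) rprog"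
  | Choice "('v, 'a, 'p) rprog" "('v, 'a, 'p) rprog"
  | Test "('v, 'a) fml"
  | Star "('v, 'a, 'p) rprog"

inductive_set rprogs :: "('v, 'a, 'p, 'u, 's) dyn_structure \<Rightarrow> ('v, 'a, 'p) rprog set"
  for D :: "('v, 'a, 'p, 'u, 's) dyn_structure" where
    Base: "r \<in> progs D \<Longrightarrow> Base r \<in> rprogs D"
  | Seq: "\<lbrakk>p \<in> rprogs D; q \<in> rprogs D\<rbrakk> \<Longrightarrow> Seq p q \<in> rprogs D"
  | Choice: "\<lbrakk>p \<in> rprogs D; q \<in> rprogs D\<rbrakk> \<Longrightarrow> Choice p q \<in> rprogs D"
  | Test: "\<phi> \<in> fmls D \<Longrightarrow> Test \<phi> \<in> rprogs D"
  | Star: "p \<in> rprogs D \<Longrightarrow> Star p \<in> rprogs D"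

definition test_rel :: "('v, 'a, 'p, 'u, 's) dyn_structure \<Rightarrow> 's set \<Rightarrow> ('s \<times> 's) set" where
  "test_rel D X = {(\<mu>, \<nu>) \<in> states D \<times> states D. \<mu> \<in> X \<and> agree D (vars D) \<mu> \<nu>}"

text \<open>
  The evaluation of the n-th power of a program whose evaluation is \<open>R\<close>. The zeroth power is the
  test for truth, whose truth set is the whole state space. It is stated through this truth set
  because truth is not a primitive formula, and there is no formula at all if there are no atoms.
  The lemma \<open>eval_rprog_power\<close> below relates this to powers formed syntactically.
\<close>

primrec power_rel ::
  "('v, 'a, 'p, 'u, 's) dyn_structure \<Rightarrow> ('s \<times> 's) set \<Rightarrow> nat \<Rightarrow> ('s \<times> 's) set" where
  "power_rel D R 0 = test_rel D (states D)"
| "power_rel D R (Suc n) = R O power_rel D R n"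

primrec eval_rprog ::
  "('v, 'a, 'p, 'u, 's) dyn_structure \<Rightarrow> ('v, 'a, 'p) rprog \<Rightarrow> ('s \<times> 's) set" where
  "eval_rprog D (Base r) = eval_prog D r"
| "eval_rprog D (Seq p q) = eval_rprog D p O eval_rprog D q"
| "eval_rprog D (Choice p q) = eval_rprog D p \<union> eval_rprog D q"
| "eval_rprog D (Test \<phi>) = test_rel D (eval_fml D \<phi>)"
| "eval_rprog D (Star p) = (\<Union>n. power_rel D (eval_rprog D p) n)"

primrec fv_rprog ::
  "('v, 'a, 'p, 'u, 's) dyn_structure \<Rightarrow> ('v, 'a, 'p) rprog \<Rightarrow> 'v set" where
  "fv_rprog D (Base r) = fv_prog D r"
| "fv_rprog D (Seq p q) = fv_rprog D p \<union> fv_rprog D q"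
| "fv_rprog D (Choice p q) = fv_rprog D p \<union> fv_rprog D q"
| "fv_rprog D (Test \<phi>) = fv_fml D \<phi>"
| "fv_rprog D (Star p) = fv_rprog D p"

definition regular_closure ::
  "('v, 'a, 'p, 'u, 's) dyn_structure \<Rightarrow>
    ('v, 'a, ('v, 'a, 'p) rprog, 'u, 's) dyn_structure" where
  "regular_closure D =
    \<lparr>vars = vars D, atoms = atoms D, progs = rprogs D, univ = univ D, states = states D,
     val = val D, eval_atom = eval_atom D, fv_atom = fv_atom D,
     eval_prog = eval_rprog D, fv_prog = fv_rprog D\<rparr>"

primrec rprog_power ::
  "('v, 'a) fml \<Rightarrow> ('v, 'a, 'p) rprog \<Rightarrow> nat \<Rightarrow> ('v, 'a, 'p) rprog" where
  "rprog_power T p 0 = Test T"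
| "rprog_power T p (Suc n) = Seq p (rprog_power T p n)"

lemma eval_rprog_power:
  assumes "eval_fml D T = states D"
  shows "eval_rprog D (rprog_power T p n) = power_rel D (eval_rprog D p) n"
  using assms by (induction n) simp_all

lemma eval_fml_excluded_middle:
  "eval_fml D (Neg (And F (Neg F))) = states D"
  by auto

end

theory Submission
  imports Defs
begin

text \<open>
  Overapproximation for a fixed \<open>W\<close> says that agreement on \<open>W\<close> is a simulation, a property
  preserved by composition and union, hence by iteration. It holds for tests by the coincidence
  property of formulas, where interpolation handles the quantifier.
\<close>

lemma agree_refl: "agree D W \<mu> \<mu>"
  by (simp add: agree_def)

lemma agree_sym: "agree D W \<mu> \<nu> \<Longrightarrow> agree D W \<nu> \<mu>"
  by (simp add: agree_def)

lemma agree_trans: "agree D W \<mu> \<nu> \<Longrightarrow> agree D W \<nu> \<omega> \<Longrightarrow> agree D W \<mu> \<omega>"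
  by (simp add: agree_def)

lemma agree_mono: "agree D W \<mu> \<nu> \<Longrightarrow> W' \<subseteq> W \<Longrightarrow> agree D W' \<mu> \<nu>"
  by (auto simp: agree_def)

lemma agree_regular_closure [simp]: "agree (regular_closure D) = agree D"
  by (intro ext) (simp add: agree_def regular_closure_def)

text \<open>\<open>W\<close> is a free parameter rather than tied to a free-variable set, so that
  subprograms with different free variables can be handled over one common \<open>W\<close>.\<close>

definition simulates :: "('v, 'a, 'p, 'u, 's) dyn_structure \<Rightarrow> 'v set \<Rightarrow> ('s \<times> 's) set \<Rightarrow> bool" where
  "simulates D W R \<longleftrightarrow>
    (\<forall>\<mu> \<nu> \<omega>. (\<mu>, \<omega>) \<in> R \<longrightarrow> \<nu> \<in> states D \<longrightarrow> agree D W \<mu> \<nu> \<longrightarrow>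
      (\<exists>\<omega>'\<in>states D. (\<nu>, \<omega>') \<in> R \<and> agree D W \<omega> \<omega>'))"

text \<open>One implication is enough: \<open>agree\<close> is symmetric, so exchanging
  \<open>\<mu>\<close> and \<open>\<nu>\<close> gives the converse between states.\<close>

definition extensional_rel :: "('v, 'a, 'p, 'u, 's) dyn_structure \<Rightarrow> ('s \<times> 's) set \<Rightarrow> bool" where
  "extensional_rel D R \<longleftrightarrow>
    (\<forall>\<mu> \<nu> \<omega>. (\<mu>, \<omega>) \<in> R \<longrightarrow> \<nu> \<in> states D \<longrightarrow> agree D (vars D) \<mu> \<nu> \<longrightarrow> (\<nu>, \<omega>) \<in> R)"

lemma simulatesE:
  assumes "simulates D W R" "(\<mu>, \<omega>) \<in> R" "\<nu> \<in> states D" "agree D W \<mu> \<nu>"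
  obtains \<omega>' where "\<omega>' \<in> states D" "(\<nu>, \<omega>') \<in> R" "agree D W \<omega> \<omega>'"
  using assms unfolding simulates_def by blast

text \<open>The state matching the intermediate one serves as the start for \<open>S\<close>. Both
  factors need the same \<open>W\<close>, which is why overapproximation must hold for every
  \<open>W\<close> above the free variables and not just for the least one.\<close>

lemma simulates_relcomp:
  assumes "simulates D W R" "simulates D W S"
  shows "simulates D W (R O S)"
  unfolding simulates_def
proof (intro allI impI)
  fix \<mu> \<nu> \<omega>
  assume "(\<mu>, \<omega>) \<in> R O S" and \<nu>: "\<nu> \<in> states D" "agree D W \<mu> \<nu>"
  then obtain \<kappa> where \<kappa>: "(\<mu>, \<kappa>) \<in> R" "(\<kappa>, \<omega>) \<in> S" by blast
  obtain \<kappa>' where \<kappa>': "\<kappa>' \<in> states D" "(\<nu>, \<kappa>') \<in> R" "agree D W \<kappa> \<kappa>'"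
    using assms(1) \<kappa>(1) \<nu> by (rule simulatesE)
  obtain \<omega>' where "\<omega>' \<in> states D" "(\<kappa>', \<omega>') \<in> S" "agree D W \<omega> \<omega>'"
    using assms(2) \<kappa>(2) \<kappa>'(1,3) by (rule simulatesE)
  with \<kappa>'(2) show "\<exists>\<omega>'\<in>states D. (\<nu>, \<omega>') \<in> R O S \<and> agree D W \<omega> \<omega>'" by blast
qed

lemma simulates_Union:
  assumes "\<And>R. R \<in> \<R> \<Longrightarrow> simulates D W R"
  shows "simulates D W (\<Union>\<R>)"
  using assms unfolding simulates_def by blast

lemma simulates_test_rel:
  assumes "W \<subseteq> vars D"
    and "\<And>\<mu> \<nu>. \<lbrakk>\<mu> \<in> X; \<mu> \<in> states D; \<nu> \<in> states D; agree D W \<mu> \<nu>\<rbrakk> \<Longrightarrow> \<nu> \<in> X"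
  shows "simulates D W (test_rel D X)"
  unfolding simulates_def
proof (intro allI impI)
  fix \<mu> \<nu> \<omega>
  assume "(\<mu>, \<omega>) \<in> test_rel D X" and \<nu>: "\<nu> \<in> states D" "agree D W \<mu> \<nu>"
  then have \<mu>: "\<mu> \<in> X" "\<mu> \<in> states D" "agree D (vars D) \<mu> \<omega>"
    by (auto simp: test_rel_def)
  \<comment> \<open>A test changes no variable, so \<open>\<nu>\<close> itself is the matching
    successor.\<close>
  have "(\<nu>, \<nu>) \<in> test_rel D X"
    using assms(2) \<mu>(1,2) \<nu> by (auto simp: test_rel_def agree_refl)
  moreover have "agree D W \<omega> \<nu>"
    using agree_mono[OF \<mu>(3) assms(1)] \<nu>(2) agree_sym agree_trans by metis
  ultimately show "\<exists>\<omega>'\<in>states D. (\<nu>, \<omega>') \<in> test_rel D X \<and> agree D W \<omega> \<omega>'"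
    using \<nu>(1) by blast
qed

text \<open>The zeroth power is a test on \<open>states D\<close>, which is trivially invariant; a
  successor power is a composition.\<close>

lemma simulates_power_rel:
  assumes "simulates D W R" "W \<subseteq> vars D"
  shows "simulates D W (power_rel D R n)"
  using assms by (induction n) (auto intro: simulates_relcomp simulates_test_rel)

lemma extensional_rel_relcomp: "extensional_rel D R \<Longrightarrow> extensional_rel D (R O S)"
  unfolding extensional_rel_def by blast

lemma extensional_rel_Union:
  assumes "\<And>R. R \<in> \<R> \<Longrightarrow> extensional_rel D R"
  shows "extensional_rel D (\<Union>\<R>)"
  using assms unfolding extensional_rel_def by blast

text \<open>A test leads to every state with the same values, not only back to its start. With the
  identity on \<open>X\<close> instead, this could fail once distinct states agree on all
  variables.\<close>

lemma extensional_rel_test_rel: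
  assumes "\<And>\<mu> \<nu>. \<lbrakk>\<mu> \<in> X; \<mu> \<in> states D; \<nu> \<in> states D; agree D (vars D) \<mu> \<nu>\<rbrakk> \<Longrightarrow> \<nu> \<in> X"
  shows "extensional_rel D (test_rel D X)"
  unfolding extensional_rel_def test_rel_def
  using assms agree_sym agree_trans by fast

text \<open>Extensionality concerns initial states only, so a successor power inherits it from its
  first factor \<open>R\<close>, and a case split replaces induction.\<close>

lemma extensional_rel_power_rel:
  assumes "extensional_rel D R"
  shows "extensional_rel D (power_rel D R n)"
  using assms by (cases n) (auto intro: extensional_rel_relcomp extensional_rel_test_rel)

lemma power_rel_states:
  assumes "R \<subseteq> states D \<times> states D"
  shows "power_rel D R n \<subseteq> states D \<times> states D"
  using assms by (induction n) (auto simp: test_rel_def)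

context dynamic_theory
begin

lemma fv_fml_vars: "F \<in> fmls D \<Longrightarrow> fv_fml D F \<subseteq> vars D"
  by (induction rule: fmls.induct) (use fv_atom_vars in auto)

lemma fv_fml_finite: "F \<in> fmls D \<Longrightarrow> finite (fv_fml D F)"
  by (induction rule: fmls.induct) (use fv_atom_finite in auto)

text \<open>The implication is proved for all pairs of states at once, so that negation can use it
  with \<open>\<mu>\<close> and \<open>\<nu>\<close> exchanged.\<close>

lemma fml_coincidence:
  assumes "F \<in> fmls D" "\<mu> \<in> states D" "\<nu> \<in> states D" "agree D (fv_fml D F) \<mu> \<nu>"
    and "\<mu> \<in> eval_fml D F"
  shows "\<nu> \<in> eval_fml D F"
  using assms
proof (induction arbitrary: \<mu> \<nu> rule: fmls.induct)
  case (Atom a)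
  then show ?case using atom_coincidence by simp
next
  case (Neg F)
  then show ?case using agree_sym by fastforce
next
  case (And F G)
  then have "agree D (fv_fml D F) \<mu> \<nu>" "agree D (fv_fml D G) \<mu> \<nu>"
    by (auto elim: agree_mono)
  with And show ?case by auto
next
  case (All v F)
  have "\<nu>' \<in> eval_fml D F" if \<nu>': "\<nu>' \<in> states D" "agree D (vars D - {v}) \<nu> \<nu>'" for \<nu>'
  proof -
    \<comment> \<open>Interpolation transfers the change at \<open>v\<close> from
      \<open>\<nu>'\<close> to \<open>\<mu>\<close>: \<open>\<mu>'\<close> takes \<open>v\<close>
      from \<open>\<nu>'\<close> and all other variables from \<open>\<mu>\<close>.\<close>
    obtain \<mu>' where \<mu>': "\<mu>' \<in> states D" "agree D {v} \<mu>' \<nu>'" "agree D (vars D - {v}) \<mu>' \<mu>"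
      using interpolation[of \<nu>' \<mu> "{v}"] \<nu>'(1) All.prems(1) All.hyps(1) by auto
    have "\<mu>' \<in> eval_fml D F"
      using All.prems(4) \<mu>'(1) agree_sym[OF \<mu>'(3)] by auto
    moreover have "agree D (fv_fml D F) \<mu>' \<nu>'"
      unfolding agree_def
    proof
      fix x
      assume "x \<in> fv_fml D F"
      then show "val D \<mu>' x = val D \<nu>' x"
        \<comment> \<open>For \<open>x\<close> other than \<open>v\<close>, the values at
          \<open>\<mu>'\<close>, \<open>\<mu>\<close>, \<open>\<nu>\<close>, \<open>\<nu>'\<close>
          coincide in turn; the middle link is the agreement on
          \<open>fv_fml D (All v F)\<close>.\<close>
        using fv_fml_vars[OF All.hyps(2)] \<mu>'(2,3) All.prems(3) \<nu>'(2)
        by (cases "x = v") (auto simp: agree_def)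
    qed
    ultimately show ?thesis using All.IH \<mu>'(1) \<nu>'(1) by blast
  qed
  with All.prems(2) show ?case by simp
qed

lemma eval_rprog_states: "p \<in> rprogs D \<Longrightarrow> eval_rprog D p \<subseteq> states D \<times> states D"
proof (induction rule: rprogs.induct)
  case (Base r)
  then show ?case using eval_prog_states by simp
next
  case (Star p)
  then show ?case unfolding eval_rprog.simps by (intro UN_least power_rel_states)
qed (auto simp: test_rel_def)

lemma fv_rprog_vars: "p \<in> rprogs D \<Longrightarrow> fv_rprog D p \<subseteq> vars D"
  by (induction rule: rprogs.induct) (simp_all add: fv_prog_vars fv_fml_vars)

lemma fv_rprog_finite: "p \<in> rprogs D \<Longrightarrow> finite (fv_rprog D p)"
  by (induction rule: rprogs.induct) (simp_all add: fv_prog_finite fv_fml_finite)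

text \<open>\<open>W\<close> stays fixed in the induction, since the free variables of a subprogram
  lie among those of the whole program.\<close>

lemma simulates_eval_rprog:
  assumes "p \<in> rprogs D" "fv_rprog D p \<subseteq> W" "W \<subseteq> vars D"
  shows "simulates D W (eval_rprog D p)"
  using assms
proof (induction rule: rprogs.induct)
  case (Base r)
  show ?case
    unfolding simulates_def
  proof (intro allI impI)
    fix \<mu> \<nu> \<omega>
    assume "(\<mu>, \<omega>) \<in> eval_rprog D (Base r)" "\<nu> \<in> states D" "agree D W \<mu> \<nu>"
    with Base show "\<exists>\<omega>'\<in>states D. (\<nu>, \<omega>') \<in> eval_rprog D (Base r) \<and> agree D W \<omega> \<omega>'"
      using overapproximation[of r W \<mu> \<nu> \<omega>] eval_prog_states[of r] by auto
  qed
next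
  case (Seq p q)
  then show ?case by (simp add: simulates_relcomp)
next
  case (Choice p q)
  \<comment> \<open>A choice is the union of a two-element family.\<close>
  then show ?case using simulates_Union[of "{eval_rprog D p, eval_rprog D q}" D W] by auto
next
  case (Test \<phi>)
  show ?case
    unfolding eval_rprog.simps
  proof (rule simulates_test_rel)
    show "W \<subseteq> vars D" by (rule Test.prems)
    show "\<nu> \<in> eval_fml D \<phi>"
      if "\<mu> \<in> eval_fml D \<phi>" "\<mu> \<in> states D" "\<nu> \<in> states D" "agree D W \<mu> \<nu>" for \<mu> \<nu>
      using that Test fml_coincidence agree_mono by (metis fv_rprog.simps(4))
  qed
next
  case (Star p)
  then show ?case by (auto intro!: simulates_Union simulates_power_rel)
qed

text \<open>Simulation with \<open>W\<close> equal to \<open>vars D\<close> would only give a final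
  state agreeing with \<open>\<omega>\<close>; here \<open>\<omega>\<close> itself must be reached,
  hence a separate induction.\<close>

lemma extensional_rel_eval_rprog: "p \<in> rprogs D \<Longrightarrow> extensional_rel D (eval_rprog D p)"
proof (induction rule: rprogs.induct)
  case (Base r)
  show ?case
    unfolding extensional_rel_def
  proof (intro allI impI)
    fix \<mu> \<nu> \<omega>
    assume "(\<mu>, \<omega>) \<in> eval_rprog D (Base r)" "\<nu> \<in> states D" "agree D (vars D) \<mu> \<nu>"
    with Base show "(\<nu>, \<omega>) \<in> eval_rprog D (Base r)"
      using extensionality[of r \<mu> \<nu> \<omega>] eval_prog_states[of r] by auto
  qed
next
  case (Seq p q)
  then show ?case by (simp add: extensional_rel_relcomp)
next
  case (Choice p q)
  then show ?case using extensional_rel_Union[of "{eval_rprog D p, eval_rprog D q}" D] by auto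
next
  case (Test \<phi>)
  show ?case
    unfolding eval_rprog.simps
  proof (rule extensional_rel_test_rel)
    show "\<nu> \<in> eval_fml D \<phi>"
      if "\<mu> \<in> eval_fml D \<phi>" "\<mu> \<in> states D" "\<nu> \<in> states D" "agree D (vars D) \<mu> \<nu>" for \<mu> \<nu>
      using that Test fml_coincidence agree_mono fv_fml_vars by metis
  qed
next
  case (Star p)
  then show ?case by (auto intro!: extensional_rel_Union extensional_rel_power_rel)
qed

end

theorem mainTheorem8:
  fixes D :: "('v, 'a, 'p, 'u, 's) dyn_structure"
  assumes "dynamic_theory D"
  shows "dynamic_theory (regular_closure D)"
proof -
  interpret dynamic_theory D by (rule assms)
  have closure_sel:
    "vars (regular_closure D) = vars D" "atoms (regular_closure D) = atoms D"
    "progs (regular_closure D) = rprogs D" "univ (regular_closure D) = univ D"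
    "states (regular_closure D) = states D" "val (regular_closure D) = val D"
    "eval_atom (regular_closure D) = eval_atom D" "fv_atom (regular_closure D) = fv_atom D"
    "eval_prog (regular_closure D) = eval_rprog D" "fv_prog (regular_closure D) = fv_rprog D"
    by (simp_all add: regular_closure_def)
  show ?thesis
  proof (unfold_locales, unfold closure_sel agree_regular_closure)
    fix p W \<mu> \<nu> \<omega>
    assume "p \<in> rprogs D" "fv_rprog D p \<subseteq> W" "W \<subseteq> vars D" "\<nu> \<in> states D" "agree D W \<mu> \<nu>"
      "(\<mu>, \<omega>) \<in> eval_rprog D p"
    then show "\<exists>\<omega>'\<in>states D. (\<nu>, \<omega>') \<in> eval_rprog D p \<and> agree D W \<omega> \<omega>'"
      using simulates_eval_rprog[of p W] unfolding simulates_def by blast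
  next
    fix p \<mu> \<nu> \<omega>
    assume "p \<in> rprogs D" "\<mu> \<in> states D" "\<nu> \<in> states D" "agree D (vars D) \<mu> \<nu>"
    then show "(\<mu>, \<omega>) \<in> eval_rprog D p \<longleftrightarrow> (\<nu>, \<omega>) \<in> eval_rprog D p"
      using extensional_rel_eval_rprog[of p] agree_sym[of D "vars D" \<mu> \<nu>]
      unfolding extensional_rel_def by blast
  \<comment> \<open>The conditions on states and atoms carry over unchanged from \<open>D\<close>;
    those left for programs are well-typedness and finiteness.\<close>
  qed (rule univ_nonempty states_nonempty val_in_univ interpolation eval_atom_states
      fv_atom_vars fv_atom_finite atom_coincidence eval_rprog_states fv_rprog_vars
      fv_rprog_finite; assumption)+
qed

end
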